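(* Let $F$ be a Banach space, let $X:\mathbb{R}\to L(F)$ be continuous and $1$-periodic, let $g(\cdot)$ be its associated fundamental solution, $g=g(1)$, and let $\phi^t$ be the associated skew-product flow on $S^1\times F$. Then \[ \mathcal{R}_c(\phi^t) = S^1 \times_g \mathcal{R}_c(g), \] where $\mathcal{R}_c(\phi^t)$ is the chain recurrent set of the continuous-time flow $\phi^t$ and $\mathcal{R}_c(g)$ is the chain recurrent set of the discrete-time flow $n\mapsto g^n$ on $F$.
   Context: Setting. $F$ is a (real or complex) Banach space with norm $|\cdot|$, $L(F)$ is the Banach space of bounded linear operators on $F$ with the operator norm, and $X:\mathbb{R}\to L(F)$ is a continuous map with $X(t+1)=X(t)$ for all $t$. The associated fundamental solution is the differentiable curve $t\mapsto g(t)\in L(F)$, $t\in\mathbb{R}$, with $g'(t)=X(t)g(t)$, $g(0)=I$; it exists uniquely on $\mathbb{R}$ and each $g(t)$ is invertible in $L(F)$. Put $g=g(1)$; then $g(t+n)=g(t)g^n$ for all $t\in\mathbb{R}$ and all natural $n$. The discrete-time flow generated by $g$ is $n\mapsto g^n$, $n\in\mathbb{Z}$, on $F$. Let $S^1=\mathbb{R}/\mathbb{Z}$ and $\overline{s}=s+\mathbb{Z}$. The associated skew-product flow on $S^1\times F$ is the (well-defined, continuous) flow $\phi^t(\overline{s},x)=(\overline{s+t},\,g(t+s)g(s)^{-1}x)$, $t\in\mathbb{R}$. $F$ carries the metric $d(x,y)=|x-y|$ and $S^1\times F$ carries the metric $\overline{d}((\overline{s},x),(\overline{r},y))=\min\{|s-r|,1-|s-r|\}+d(x,y)$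 for $s,r\in[0,1)$, $x,y\in F$. For a subset $E\subset F$ that is $g$-invariant (i.e. $g^n(E)=E$ for all $n\in\mathbb{Z}$), define $S^1\times_g E=\bigcup_{s\in\mathbb{R}}\{\overline{s}\}\times g(s)E\subset S^1\times F$. Let $\sigma^t$ ($t\in\mathbb{R}$ or $t\in\mathbb{Z}$) be a flow on a metric space $(U,d)$, and let $\mathcal{P}(U)$ be the set of all positive continuous functions $U\to\mathbb{R}$. Given $x,y\in U$, $\varepsilon\in\mathcal{P}(U)$ and $t>0$, an $(\varepsilon,t)$-chain from $x$ to $y$ consists of an integer $k\geq 1$, times $t_1,\ldots,t_k>t$ and points $x_1,\ldots,x_{k+1}\in U$ with $x_1=x$, $x_{k+1}=y$ and $d(x_{i+1},\sigma^{t_i}(x_i))<\varepsilon(\sigma^{t_i}(x_i))$ for $i=1,\ldots,k$ (times are real for a continuous-time flow and integers for a discrete-time flow). Points $x,y$ are chain equivalent if for all $\varepsilon\in\mathcal{P}(U)$ and $t>0$ there exist an $(\varepsilon,t)$-chain from $x$ to $y$ and one from $y$ to $x$. A point is chain recurrent if it is chain equivalent to itself; the chain recurrent set $\mathcal{R}_c(\sigma^t)$ is the set of all chain recurrent points (it is invariant under the flow). *)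

theory Defs
  imports "HOL-Analysis.Analysis"
begin

section \<open>Chain recurrence\<close>

text \<open>
  Flows are functions \<open>\<sigma> :: 'time \<Rightarrow> 'u \<Rightarrow> 'u\<close>, with \<open>'time\<close> instantiated to \<open>real\<close>
  (continuous time) or \<open>int\<close> (discrete time). The metric is an explicit argument because
  the library's \<^const>\<open>dist\<close> on product types is the Euclidean combination of the two
  distances, whereas the sum is needed below.
\<close>

definition positive_continuous :: "('u \<Rightarrow> 'u \<Rightarrow> real) \<Rightarrow> ('u \<Rightarrow> real) set" where
  "positive_continuous d =
     {e. continuous_map (Metric_space.mtopology UNIV d) euclideanreal e \<and> (\<forall>u. 0 < e u)}"

definition has_chain ::
  "('u \<Rightarrow> 'u \<Rightarrow> real) \<Rightarrow> ('time::linordered_idom \<Rightarrow> 'u \<Rightarrow> 'u) \<Rightarrow> ('u \<Rightarrow> real) \<Rightarrow> 'time \<Rightarrow> 'u \<Rightarrow> 'u \<Rightarrow> bool"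
  where
  "has_chain d \<sigma> e t x y \<longleftrightarrow>
     (\<exists>(k::nat) (ts :: nat \<Rightarrow> 'time) (xs :: nat \<Rightarrow> 'u).
        k \<ge> 1 \<and> (\<forall>i\<in>{1..k}. ts i > t) \<and> xs 1 = x \<and> xs (k + 1) = y \<and>
        (\<forall>i\<in>{1..k}. d (xs (i + 1)) (\<sigma> (ts i) (xs i)) < e (\<sigma> (ts i) (xs i))))"

definition chain_equivalent ::
  "('u \<Rightarrow> 'u \<Rightarrow> real) \<Rightarrow> ('time::linordered_idom \<Rightarrow> 'u \<Rightarrow> 'u) \<Rightarrow> 'u \<Rightarrow> 'u \<Rightarrow> bool" where
  "chain_equivalent d \<sigma> x y \<longleftrightarrow>
     (\<forall>e\<in>positive_continuous d. \<forall>t>0. has_chain d \<sigma> e t x y \<and> has_chain d \<sigma> e t y x)"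

definition chain_recurrent_set ::
  "('u \<Rightarrow> 'u \<Rightarrow> real) \<Rightarrow> ('time::linordered_idom \<Rightarrow> 'u \<Rightarrow> 'u) \<Rightarrow> 'u set" where
  "chain_recurrent_set d \<sigma> = {x. chain_equivalent d \<sigma> x x}"


section \<open>The circle \<open>\<real>/\<int>\<close> and the metric on its product with a normed space\<close>

quotient_type circle = real / "\<lambda>s r::real. s - r \<in> \<int>"
  morphisms some_representative circle_of
proof (rule equivpI)
  show "reflp (\<lambda>s r::real. s - r \<in> \<int>)"
    by (simp add: reflp_def)
  show "symp (\<lambda>s r::real. s - r \<in> \<int>)"
    unfolding symp_def by (metis Ints_minus minus_diff_eq)
  show "transp (\<lambda>s r::real. s - r \<in> \<int>)"
    unfolding transp_def by (metis Ints_add diff_add_cancel add_diff_eq)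
qed

text \<open>The representative in the interval \<open>[0,1)\<close>.\<close>

lift_definition circle_rep :: "circle \<Rightarrow> real" is frac
proof -
  fix s r :: real assume "s - r \<in> \<int>"
  then obtain n :: int where "s = r + of_int n"
    by (metis Ints_cases add.commute diff_add_cancel)
  then show "frac s = frac r"
    by (simp add: frac_def)
qed

definition circle_dist :: "circle \<Rightarrow> circle \<Rightarrow> real" where
  "circle_dist a b =
     min \<bar>circle_rep a - circle_rep b\<bar> (1 - \<bar>circle_rep a - circle_rep b\<bar>)"

definition skew_dist :: "circle \<times> 'a::real_normed_vector \<Rightarrow> circle \<times> 'a \<Rightarrow> real" where
  "skew_dist p q = circle_dist (fst p) (fst q) + dist (snd p) (snd q)"

lemma circle_of_eq_iff: "circle_of s = circle_of r \<longleftrightarrow> s - r \<in> \<int>"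
  by (rule circle.abs_eq_iff)

lemma circle_rep_circle_of: "circle_rep (circle_of s) = frac s"
  by (rule circle_rep.abs_eq)

lemma circle_rep_bounds: "0 \<le> circle_rep c" "circle_rep c < 1"
  by (transfer, simp add: frac_lt_1)+

lemma circle_of_circle_rep: "circle_of (circle_rep c) = c"
proof (rule circle.abs_induct[of "\<lambda>c. circle_of (circle_rep c) = c"])
  fix s :: real
  have "frac s - s = of_int (- \<lfloor>s\<rfloor>)"
    by (simp add: frac_def)
  then show "circle_of (circle_rep (circle_of s)) = circle_of s"
    by (metis Ints_of_int circle_of_eq_iff circle_rep_circle_of)
qed

lemma Metric_space_skew_dist:
  "Metric_space UNIV (skew_dist :: circle \<times> 'a::real_normed_vector \<Rightarrow> circle \<times> 'a \<Rightarrow> real)"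
proof
  have nonneg: "0 \<le> circle_dist a b" for a b
    using circle_rep_bounds[of a] circle_rep_bounds[of b] by (simp add: circle_dist_def)
  have eq: "circle_dist a b = 0 \<longleftrightarrow> a = b" for a b
  proof
    assume "circle_dist a b = 0"
    then have "circle_rep a = circle_rep b"
      using circle_rep_bounds[of a] circle_rep_bounds[of b]
      by (auto simp: circle_dist_def min_def split: if_splits)
    then show "a = b"
      by (metis circle_of_circle_rep)
  qed (simp add: circle_dist_def)
  have tri: "circle_dist a c \<le> circle_dist a b + circle_dist b c" for a b c
    using circle_rep_bounds[of a] circle_rep_bounds[of b] circle_rep_bounds[of c]
    unfolding circle_dist_def min_def abs_if by (auto split: if_splits)
  fix p q r :: "circle \<times> 'a"
  show "0 \<le> skew_dist p q"
    by (simp add: skew_dist_def nonneg)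
  show "skew_dist p q = skew_dist q p"
    by (simp add: skew_dist_def circle_dist_def dist_commute abs_minus_commute)
  show "(skew_dist p q = 0) = (p = q)"
    by (simp add: skew_dist_def add_nonneg_eq_0_iff nonneg eq prod_eq_iff)
  show "skew_dist p r \<le> skew_dist p q + skew_dist q r"
    using tri[of "fst p" "fst r" "fst q"] dist_triangle[of "snd p" "snd r" "snd q"]
    by (simp add: skew_dist_def)
qed


section \<open>Linear flows\<close>

text \<open>
  \<open>L(F)\<close> is the type \<open>'a \<Rightarrow>\<^sub>L 'a\<close> for a real Banach space \<open>'a\<close>. A complex Banach space is
  covered by restricting scalars: this changes neither the norm nor the operator norm,
  and complex-linear operators form a closed subalgebra.
\<close>

definition fundamental_solution ::
  "(real \<Rightarrow> ('a::banach \<Rightarrow>\<^sub>L 'a)) \<Rightarrow> (real \<Rightarrow> ('a \<Rightarrow>\<^sub>L 'a)) \<Rightarrow> bool" where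
  "fundamental_solution X g \<longleftrightarrow>
     g 0 = id_blinfun \<and> (\<forall>t. (g has_vector_derivative (X t o\<^sub>L g t)) (at t))"

definition discrete_flow :: "('a::banach \<Rightarrow>\<^sub>L 'a) \<Rightarrow> int \<Rightarrow> 'a \<Rightarrow> 'a" where
  "discrete_flow A n =
     (if 0 \<le> n then blinfun_apply A ^^ nat n else inv (blinfun_apply A) ^^ nat (- n))"

text \<open>
  The formula for the skew-product flow does not depend on the representative \<open>s\<close> of the
  point of the circle; the definition takes the one in \<open>[0,1)\<close>, and the lemma after it
  gives the formula for an arbitrary representative.
\<close>

definition skew_flow ::
  "(real \<Rightarrow> ('a::banach \<Rightarrow>\<^sub>L 'a)) \<Rightarrow> real \<Rightarrow> circle \<times> 'a \<Rightarrow> circle \<times> 'a" where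
  "skew_flow g t p =
     (let s = circle_rep (fst p)
      in (circle_of (s + t), g (t + s) (inv (blinfun_apply (g s)) (snd p))))"

lemma skew_flow_circle_of:
  fixes g :: "real \<Rightarrow> ('a::banach \<Rightarrow>\<^sub>L 'a)"
  assumes bij: "\<And>t. bij (blinfun_apply (g t))"
    and shift: "\<And>t. g (t + 1) = g t o\<^sub>L g 1"
  shows "skew_flow g t (circle_of s, x) =
    (circle_of (s + t), g (t + s) (inv (blinfun_apply (g s)) x))"
proof -
  define D where "D r = g (t + r) (inv (blinfun_apply (g r)) x)" for r
  have step: "D (r + 1) = D r" for r
  proof -
    have "blinfun_apply (g (r + 1)) = blinfun_apply (g r) \<circ> blinfun_apply (g 1)"
      by (simp add: shift fun_eq_iff)
    then have "inv (blinfun_apply (g (r + 1))) x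
        = inv (blinfun_apply (g 1)) (inv (blinfun_apply (g r)) x)"
      using bij by (simp add: o_inv_distrib)
    moreover have "g (t + (r + 1)) = g (t + r) o\<^sub>L g 1"
      using shift[of "t + r"] by (simp add: add.assoc)
    ultimately show ?thesis
      using bij by (simp add: D_def surj_f_inv_f bij_is_surj)
  qed
  have period: "D (r + of_int n) = D r" for r and n :: int
  proof (induct n rule: int_induct[where k = 0])
    case (step1 i)
    then show ?case using step[of "r + of_int i"] by (simp add: add.assoc)
  next
    case (step2 i)
    then show ?case using step[of "r + of_int (i - 1)"] by (simp add: algebra_simps)
  qed simp
  have s: "s = frac s + of_int \<lfloor>s\<rfloor>"
    by (simp add: frac_def)
  have "D s = D (frac s)"
    by (subst s) (rule period)
  moreover have "circle_of (frac s + t) = circle_of (s + t)"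
    by (simp add: circle_of_eq_iff frac_def)
  ultimately show ?thesis
    by (simp add: skew_flow_def Let_def circle_rep_circle_of D_def)
qed

definition twisted_product ::
  "(real \<Rightarrow> ('a::banach \<Rightarrow>\<^sub>L 'a)) \<Rightarrow> 'a set \<Rightarrow> (circle \<times> 'a) set" where
  "twisted_product g E = (\<Union>s. {circle_of s} \<times> (blinfun_apply (g s) ` E))"

end

theory Submission
  imports Defs
begin

text \<open>
  Both inclusions come from a map that carries single jumps of one flow to single jumps of
  the other; such a map carries chains to chains, hence chain recurrent points to chain
  recurrent points (\<open>chain_recurrent_set_map\<close>).

  From \<open>F\<close> to \<open>S\<^sup>1 \<times> F\<close> the map is \<open>x \<mapsto> (s, g(s)x)\<close> for a fixed \<open>s\<close>. It conjugates \<open>g\<^sup>n\<close> to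
  \<open>\<phi>\<^sup>n\<close>, since \<open>g(s + n) = g(s)g\<^sup>n\<close>, and it stretches distances at most by the factor
  \<open>|g(s)| + 1\<close>; dividing the error function by this factor compensates.

  From \<open>S\<^sup>1 \<times> F\<close> to \<open>F\<close> the map is \<open>Z(s, x) = g(s)\<^sup>-\<^sup>1x\<close> with \<open>s \<in> [0,1)\<close>. Along the flow \<open>Z\<close> changes
  by an integral power of \<open>g\<close>, one factor for each passage through \<open>s = 0\<close>, so a flow
  segment of real length turns into an orbit segment of integral length. The map \<open>Z\<close> is
  discontinuous at \<open>s = 0\<close>, but only up to a factor \<open>g\<close>: points near \<open>p\<close> have
  a \<open>Z\<close>-value \<open>g\<^sup>mu\<close> with \<open>|m| \<le> 1\<close> and \<open>u\<close> near \<open>Z(p)\<close> (\<open>section_coord_near\<close>). A small jump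
  from \<open>p\<close> to \<open>q\<close> thus leaves \<open>Z(q)\<close> close to \<open>g\<^sup>jZ(p)\<close> for some \<open>|j| \<le> 2\<close>, and \<open>j\<close> is
  absorbed into the time of the segment before the jump, which stays as long as required if
  the times of the original chain are longer by 3.

  How small a jump has to be depends on the point, and it must be governed by a
  continuous function. It suffices to find a bound that works uniformly near each point;
  \<open>positive_continuous_selection\<close> turns such local bounds into a continuous function.

  The facts used about \<open>g\<close> are its invertibility, the relation \<open>g(t + n) = g(t)g\<^sup>n\<close> and the
  joint continuity of \<open>(t, x) \<mapsto> g(t)\<^sup>-\<^sup>1x\<close>. All of them follow from one estimate: over a time
  step of some fixed length \<open>h > 0\<close> no solution moves by more than half of its norm
  (\<open>linear_ode_short_time\<close>).
\<close>

section \<open>Chain recurrence under maps that carry jumps to jumps\<close>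

lemma positive_continuous_iff:
  assumes "Metric_space UNIV d"
  shows "e \<in> positive_continuous d \<longleftrightarrow>
    (\<forall>u. 0 < e u) \<and> (\<forall>u. \<forall>\<eta>>0. \<exists>\<delta>>0. \<forall>v. d u v < \<delta> \<longrightarrow> \<bar>e u - e v\<bar> < \<eta>)"
  using Metric_space.metric_continuous_map[OF assms Met_TC.Metric_space_axioms, of e]
  by (auto simp: positive_continuous_def dist_real_def)

lemma has_chain_map:
  fixes \<sigma> :: "'s::linordered_idom \<Rightarrow> 'u \<Rightarrow> 'u" and \<sigma>' :: "'t::linordered_idom \<Rightarrow> 'v \<Rightarrow> 'v"
  assumes jump: "\<And>p q \<tau>. \<lbrakk>\<tau> > t; d q (\<sigma> \<tau> p) < e (\<sigma> \<tau> p)\<rbrakk> \<Longrightarrow>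
      \<exists>\<tau>'>t'. d' (f q) (\<sigma>' \<tau>' (f p)) < e' (\<sigma>' \<tau>' (f p))"
    and chain: "has_chain d \<sigma> e t x y"
  shows "has_chain d' \<sigma>' e' t' (f x) (f y)"
proof -
  from chain obtain k :: nat and ts xs where k: "k \<ge> 1" "xs 1 = x" "xs (k + 1) = y"
    and ts: "\<And>i. i \<in> {1..k} \<Longrightarrow> ts i > t"
    and xs: "\<And>i. i \<in> {1..k} \<Longrightarrow> d (xs (i + 1)) (\<sigma> (ts i) (xs i)) < e (\<sigma> (ts i) (xs i))"
    unfolding has_chain_def by blast
  have "\<forall>i\<in>{1..k}. \<exists>\<tau>'>t'. d' (f (xs (i + 1))) (\<sigma>' \<tau>' (f (xs i))) < e' (\<sigma>' \<tau>' (f (xs i)))"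
    using jump ts xs by blast
  then obtain ts' where "\<forall>i\<in>{1..k}. ts' i > t' \<and>
      d' (f (xs (i + 1))) (\<sigma>' (ts' i) (f (xs i))) < e' (\<sigma>' (ts' i) (f (xs i)))"
    by metis
  then show ?thesis
    unfolding has_chain_def using k
    by (intro exI[of _ k] exI[of _ ts'] exI[of _ "f \<circ> xs"]) auto
qed

text \<open>
  The map \<open>f\<close> may be discontinuous and the two flows may have different kinds of time: only
  the endpoints of single jumps matter.
\<close>

lemma chain_recurrent_set_map:
  fixes \<sigma> :: "'s::linordered_idom \<Rightarrow> 'u \<Rightarrow> 'u" and \<sigma>' :: "'t::linordered_idom \<Rightarrow> 'v \<Rightarrow> 'v"
  assumes jump: "\<And>e' t'. \<lbrakk>e' \<in> positive_continuous d'; t' > 0\<rbrakk> \<Longrightarrow>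
      \<exists>e\<in>positive_continuous d. \<exists>t>0. \<forall>p q. \<forall>\<tau>>t. d q (\<sigma> \<tau> p) < e (\<sigma> \<tau> p) \<longrightarrow>
        (\<exists>\<tau>'>t'. d' (f q) (\<sigma>' \<tau>' (f p)) < e' (\<sigma>' \<tau>' (f p)))"
    and x: "x \<in> chain_recurrent_set d \<sigma>"
  shows "f x \<in> chain_recurrent_set d' \<sigma>'"
proof -
  have "has_chain d' \<sigma>' e' t' (f x) (f x)" if e': "e' \<in> positive_continuous d'" "t' > 0" for e' t'
  proof -
    obtain e t where et: "e \<in> positive_continuous d" "t > 0"
      and j: "\<forall>p q. \<forall>\<tau>>t. d q (\<sigma> \<tau> p) < e (\<sigma> \<tau> p) \<longrightarrow>
        (\<exists>\<tau>'>t'. d' (f q) (\<sigma>' \<tau>' (f p)) < e' (\<sigma>' \<tau>' (f p)))"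
      using jump[OF e'] by blast
    have chain: "has_chain d \<sigma> e t x x"
      using x et by (auto simp: chain_recurrent_set_def chain_equivalent_def)
    show ?thesis
      by (rule has_chain_map[OF _ chain]) (use j in blast)
  qed
  then show ?thesis
    by (auto simp: chain_recurrent_set_def chain_equivalent_def)
qed

text \<open>
  The gauge at \<open>p\<close> is half the supremum \<open>\<rho>(p)\<close> of the radii \<open>r \<le> 1\<close> such that \<open>P q r\<close> holds
  on the whole \<open>r\<close>-ball around \<open>p\<close>. An \<open>r\<close>-ball around \<open>p\<close> contains the ball of radius
  \<open>r - d p q\<close> around \<open>q\<close>, so \<open>\<rho>\<close> is 1-Lipschitz, in particular continuous. Taking half of it
  leaves an admissible radius above the gauge.
\<close>

lemma positive_continuous_selection:
  assumes d: "Metric_space UNIV d"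
    and antitone: "\<And>p r r'. \<lbrakk>P p r; 0 < r'; r' \<le> r\<rbrakk> \<Longrightarrow> P p r'"
    and local: "\<And>p. \<exists>r>0. \<forall>q. d p q < r \<longrightarrow> P q r"
  shows "\<exists>e\<in>positive_continuous d. \<forall>p. P p (e p)"
proof -
  interpret Metric_space UNIV d by (fact d)
  define A where "A p = {r. 0 < r \<and> r \<le> 1 \<and> (\<forall>q. d p q < r \<longrightarrow> P q r)}" for p
  define \<rho> where "\<rho> p = Sup (A p)" for p
  have bdd: "bdd_above (A p)" for p
    by (rule bdd_aboveI[of _ 1]) (auto simp: A_def)
  have ne: "A p \<noteq> {}" for p
  proof -
    obtain r where "r > 0" "\<forall>q. d p q < r \<longrightarrow> P q r" using local by blast
    then have "min r 1 \<in> A p" by (auto simp: A_def intro: antitone)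
    then show ?thesis by blast
  qed
  have pos: "\<rho> p > 0" for p
  proof -
    obtain r where r: "r \<in> A p" using ne by blast
    then have "r \<le> \<rho> p" unfolding \<rho>_def by (rule cSup_upper[OF _ bdd])
    then show ?thesis using r by (auto simp: A_def)
  qed
  have P: "P p (\<rho> p / 2)" for p
  proof -
    have "\<rho> p / 2 < Sup (A p)" using pos[of p] by (simp add: \<rho>_def)
    then obtain r where r: "r \<in> A p" "\<rho> p / 2 < r" using less_cSupE[OF _ ne] by blast
    then have "P p r" by (simp add: A_def)
    then show ?thesis by (rule antitone) (use r pos[of p] in auto)
  qed
  have lip: "\<rho> p - d p q \<le> \<rho> q" for p q
  proof -
    have "r \<le> \<rho> q + d p q" if r: "r \<in> A p" for r
    proof (cases "d p q < r")
      case True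
      have "P z (r - d p q)" if z: "d q z < r - d p q" for z
      proof -
        have "d p z < r" using triangle[of p q z] z by simp
        then have "P z r" using r by (simp add: A_def)
        then show ?thesis by (rule antitone) (use True in auto)
      qed
      moreover have "r \<le> 1" using r by (simp add: A_def)
      then have "r - d p q \<le> 1" using nonneg[of p q] by linarith
      ultimately have "r - d p q \<in> A q" using True by (simp add: A_def)
      then have "r - d p q \<le> \<rho> q" unfolding \<rho>_def by (rule cSup_upper[OF _ bdd])
      then show ?thesis by simp
    next
      case False
      then show ?thesis using pos[of q] by simp
    qed
    then have "\<rho> p \<le> \<rho> q + d p q" unfolding \<rho>_def[of p] by (rule cSup_least[OF ne])
    then show ?thesis by simp
  qed
  have "(\<lambda>p. \<rho> p / 2) \<in> positive_continuous d"
  proof -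
    have "\<bar>\<rho> u / 2 - \<rho> v / 2\<bar> < \<eta>" if "d u v < \<eta>" for u v \<eta>
      using lip[of u v] lip[of v u] commute[of u v] nonneg[of u v] that by linarith
    then show ?thesis using pos by (auto simp: positive_continuous_iff[OF d])
  qed
  then show ?thesis using P by (intro bexI[of _ "\<lambda>p. \<rho> p / 2"]) auto
qed

section \<open>The fundamental solution\<close>

text \<open>
  If \<open>K\<close> is the maximum of \<open>|y|\<close> between \<open>s\<close> and \<open>t\<close>, the mean value inequality bounds the
  displacement by \<open>M K |t - s| \<le> K/4\<close>. Hence \<open>K \<le> |y(s)| + K/4\<close>, that is \<open>K \<le> 4/3 |y(s)|\<close>.
  This takes the place of Gronwall's inequality in what follows.
\<close>

lemma linear_ode_short_time:
  fixes y :: "real \<Rightarrow> 'a::real_normed_vector" and X :: "real \<Rightarrow> 'a \<Rightarrow>\<^sub>L 'a"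
  assumes der: "\<And>t. (y has_vector_derivative X t (y t)) (at t)"
    and X: "\<And>t. norm (X t) \<le> M" and M: "M > 0" and st: "\<bar>t - s\<bar> \<le> 1 / (4 * M)"
  shows "norm (y t - y s) \<le> norm (y s) / 2"
proof -
  let ?S = "closed_segment s t"
  have "continuous_on ?S (\<lambda>u. norm (y u))"
    using der by (intro continuous_intros continuous_at_imp_continuous_on)
      (auto intro: has_vector_derivative_continuous)
  then obtain w where w: "w \<in> ?S" "\<And>u. u \<in> ?S \<Longrightarrow> norm (y u) \<le> norm (y w)"
    using continuous_attains_sup[of ?S "\<lambda>u. norm (y u)"] by auto
  define K where "K = norm (y w)"
  have bound: "norm (y u - y s) \<le> K / 4" if u: "u \<in> ?S" for u
  proof -
    have "norm (y u - y s) \<le> (M * K) * norm (u - s)"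
    proof (rule differentiable_bound[of ?S y "\<lambda>v x. x *\<^sub>R X v (y v)"])
      fix v assume v: "v \<in> ?S"
      show "(y has_derivative (\<lambda>x. x *\<^sub>R X v (y v))) (at v within ?S)"
        using der[of v] has_vector_derivative_at_within
        unfolding has_vector_derivative_def[symmetric] by blast
      have "norm (X v (y v)) \<le> norm (X v) * norm (y v)" by (rule norm_blinfun)
      also have "\<dots> \<le> M * K" unfolding K_def
        using X[of v] w(2)[OF v] M by (intro mult_mono) auto
      finally have "norm (X v (y v)) \<le> M * K" .
      then show "onorm (\<lambda>x. x *\<^sub>R X v (y v)) \<le> M * K"
        using M by (intro onorm_bound)
          (simp_all add: K_def mult_left_mono mult.commute[of _ "\<bar>_\<bar>"])
    qed (use u in auto)
    also have "\<dots> \<le> (M * K) * (1 / (4 * M))"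
    proof (intro mult_left_mono)
      have "\<bar>u - s\<bar> \<le> \<bar>t - s\<bar>" using u by (auto simp: closed_segment_eq_real_ivl split: if_splits)
      then show "norm (u - s) \<le> 1 / (4 * M)" using st by simp
    qed (use M K_def in auto)
    also have "\<dots> = K / 4" using M by (simp add: field_simps)
    finally show ?thesis .
  qed
  have "K \<le> norm (y s) + norm (y w - y s)"
    unfolding K_def by (metis add.commute diff_add_cancel norm_triangle_ineq)
  then have "K \<le> 4 / 3 * norm (y s)" using bound[OF w(1)] by simp
  moreover have "norm (y t - y s) \<le> K / 4" using bound by simp
  ultimately show ?thesis using norm_ge_zero[of "y s"] by linarith
qed

text \<open>
  The short-time estimate has the same step length at every time, so its consequences
  reach every \<open>t\<close> in finitely many steps of equal length.
\<close>

lemma real_propagate: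
  fixes h :: real
  assumes "h > 0" "Q 0" and step: "\<And>s t. \<lbrakk>Q s; \<bar>t - s\<bar> \<le> h\<rbrakk> \<Longrightarrow> Q t"
  shows "Q t"
proof -
  obtain k :: nat where k: "\<bar>t\<bar> < real k * h" using reals_Archimedean3[OF \<open>h > 0\<close>] by blast
  then have "k > 0" by (cases k) auto
  have "Q (real j * (t / real k))" for j
  proof (induction j)
    case (Suc j)
    have "\<bar>real (Suc j) * (t / real k) - real j * (t / real k)\<bar> = \<bar>t\<bar> / real k"
      by (simp add: left_diff_distrib[symmetric] diff_divide_distrib[symmetric])
    also have "\<dots> \<le> h" using k \<open>k > 0\<close> by (simp add: field_simps)
    finally show ?case using step[OF Suc] by blast
  qed (simp add: assms)
  from this[of k] show ?thesis using \<open>k > 0\<close> by simp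
qed

text \<open>
  With \<open>f = A\<^sup>-\<^sup>1\<close> (possibly unbounded), the map \<open>v \<mapsto> w + v - B(f v)\<close> is a contraction with
  constant \<open>1/2\<close>; if \<open>v\<close> is its fixed point, \<open>B(f v) = w\<close>.
\<close>

lemma bij_blinfun_perturb:
  fixes A B :: "'a::real_normed_vector \<Rightarrow>\<^sub>L 'b::banach"
  assumes A: "bij (blinfun_apply A)" and AB: "\<And>x. norm (B x - A x) \<le> norm (A x) / 2"
  shows "bij (blinfun_apply B)"
proof (rule bijI)
  show "inj (blinfun_apply B)"
  proof (rule injI)
    fix x y assume "B x = B y"
    then have "B (x - y) = 0" by (simp add: blinfun.diff_right)
    then have "A (x - y) = 0" using AB[of "x - y"] by simp
    then show "x = y" using A by (simp add: blinfun.diff_right bij_def inj_eq)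
  qed
  show "surj (blinfun_apply B)"
  proof (rule surjI)
    fix w
    let ?f = "inv (blinfun_apply A)"
    let ?T = "\<lambda>v. w + v - B (?f v)"
    have Af: "A (?f v) = v" for v using A by (simp add: surj_f_inv_f bij_is_surj)
    have "dist (?T u) (?T v) \<le> 1/2 * dist u v" for u v
    proof -
      have "?T u - ?T v = - (B (?f u - ?f v) - A (?f u - ?f v))"
        by (simp add: blinfun.diff_right Af)
      then have "dist (?T u) (?T v) = norm (B (?f u - ?f v) - A (?f u - ?f v))"
        unfolding dist_norm by (simp only: norm_minus_cancel)
      then show ?thesis
        using AB[of "?f u - ?f v"] by (simp add: dist_norm blinfun.diff_right[of A] Af)
    qed
    then have "\<exists>!v. ?T v = v" by (intro banach_fix_type[of "1/2"]) auto
    then obtain v where "?T v = v" by blast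
    then have "B (?f v) = w" by (simp add: algebra_simps)
    then show "B (SOME x. B x = w) = w" by (rule someI)
  qed
qed

locale periodic_linear_ode =
  fixes X g :: "real \<Rightarrow> ('a::banach \<Rightarrow>\<^sub>L 'a)"
  assumes continuous_X: "continuous_on UNIV X"
    and periodic_X: "X (t + 1) = X t"
    and fundamental: "fundamental_solution X g"
begin

lemma periodic_X_int: "X (t + of_int n) = X t"
proof (induction n arbitrary: t rule: int_induct[where k = 0])
  case (step1 i)
  then show ?case using periodic_X[of "t + of_int i"] by (simp add: add.assoc)
next
  case (step2 i)
  then show ?case using periodic_X[of "t + of_int (i - 1)"] by (simp add: algebra_simps)
qed simp

lemma bounded_X: obtains M where "M > 0" "\<And>t. norm (X t) \<le> M"
proof -
  have "bounded (X ` {0..1})"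
    by (intro compact_imp_bounded compact_continuous_image continuous_on_subset[OF continuous_X]) auto
  then obtain M where M: "M > 0" "\<And>t. t \<in> {0..1} \<Longrightarrow> norm (X t) \<le> M"
    unfolding bounded_pos by blast
  have "norm (X t) \<le> M" for t
    using M(2)[of "frac t"] periodic_X_int[of "frac t" "\<lfloor>t\<rfloor>"] frac_ge_0[of t] frac_lt_1[of t]
    by (simp add: frac_def)
  with M(1) show thesis using that by blast
qed

lemma short_time:
  "\<exists>h>0. \<forall>y. (\<forall>t. (y has_vector_derivative X t (y t)) (at t)) \<longrightarrow>
    (\<forall>s t. \<bar>t - s\<bar> \<le> h \<longrightarrow> norm (y t - y s) \<le> norm (y s) / 2)"
proof -
  obtain M where M: "M > 0" "\<And>t. norm (X t) \<le> M" using bounded_X by blast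
  then show ?thesis using linear_ode_short_time[of _ X M]
    by (intro exI[of _ "1 / (4 * M)"]) simp
qed

lemma g_0 [simp]: "g 0 = id_blinfun"
  using fundamental by (simp add: fundamental_solution_def)

lemma g_derivative: "((\<lambda>t. g t x) has_vector_derivative X t (g t x)) (at t)"
proof -
  have "(g has_vector_derivative (X t o\<^sub>L g t)) (at t)"
    using fundamental by (simp add: fundamental_solution_def)
  from bounded_linear.has_vector_derivative[OF blinfun.bounded_linear_left this, of x]
  show ?thesis by simp
qed

lemma solution_unique:
  assumes der: "\<And>t. (y has_vector_derivative X t (y t)) (at t)" and "y 0 = 0"
  shows "y t = 0"
proof -
  obtain h where h: "h > 0" "\<And>s t. \<bar>t - s\<bar> \<le> h \<Longrightarrow> norm (y t - y s) \<le> norm (y s) / 2"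
    using short_time der by blast
  show ?thesis by (rule real_propagate[of h "\<lambda>t. y t = 0"]) (use h \<open>y 0 = 0\<close> in force)+
qed

lemma g_short_time:
  obtains h where "h > 0"
    "\<And>x s t. \<bar>t - s\<bar> \<le> h \<Longrightarrow> norm (g t x - g s x) \<le> norm (g s x) / 2"
proof -
  obtain h where h: "h > 0"
    and short: "\<forall>y. (\<forall>t. (y has_vector_derivative X t (y t)) (at t)) \<longrightarrow>
      (\<forall>s t. \<bar>t - s\<bar> \<le> h \<longrightarrow> norm (y t - y s) \<le> norm (y s) / 2)"
    using short_time by blast
  have "norm (g t x - g s x) \<le> norm (g s x) / 2" if "\<bar>t - s\<bar> \<le> h" for x s t
    using short[rule_format, of "\<lambda>t. g t x", OF g_derivative that] .
  with h show thesis by (rule that)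
qed

text \<open>
  Both sides solve the equation, by periodicity of \<open>X\<close>, and they agree at \<open>t = 0\<close>.
\<close>

lemma g_add_int: "g (t + of_int n) x = g t (g (of_int n) x)"
proof -
  let ?y = "\<lambda>t. g (t + of_int n) x - g t (g (of_int n) x)"
  have "(?y has_vector_derivative X t (?y t)) (at t)" for t
  proof -
    have "((\<lambda>t. t + of_int n) has_vector_derivative 1) (at t)"
      by (auto intro!: derivative_eq_intros)
    from vector_diff_chain_at[OF this g_derivative]
    have "((\<lambda>t. g (t + of_int n) x) has_vector_derivative X t (g (t + of_int n) x)) (at t)"
      by (simp add: o_def periodic_X_int)
    from has_vector_derivative_diff[OF this g_derivative]
    show ?thesis by (simp add: blinfun.diff_right)
  qed
  then have "?y t = 0" by (rule solution_unique) simp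
  then show ?thesis by simp
qed

text \<open>
  The lower bound says that \<open>g(t)\<^sup>-\<^sup>1\<close> is bounded. One short time step preserves bijectivity by
  \<open>bij_blinfun_perturb\<close> and at most doubles the constant \<open>C\<close>.
\<close>

lemma g_bij_bounded_below: "bij (blinfun_apply (g t)) \<and> (\<exists>C>0. \<forall>x. norm x \<le> C * norm (g t x))"
proof -
  obtain h where h: "h > 0"
    and short: "\<And>x s t. \<bar>t - s\<bar> \<le> h \<Longrightarrow> norm (g t x - g s x) \<le> norm (g s x) / 2"
    using g_short_time by blast
  show ?thesis
  proof (rule real_propagate[OF h])
    show "bij (blinfun_apply (g 0)) \<and> (\<exists>C>0. \<forall>x. norm x \<le> C * norm (g 0 x))"
      by (auto simp: id_def[symmetric] intro!: exI[of _ 1])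
  next
    fix s t assume s: "bij (blinfun_apply (g s)) \<and> (\<exists>C>0. \<forall>x. norm x \<le> C * norm (g s x))"
      and st: "\<bar>t - s\<bar> \<le> h"
    have "bij (blinfun_apply (g t))"
      by (rule bij_blinfun_perturb[OF conjunct1[OF s] short[OF st]])
    moreover obtain C where C: "C > 0" "\<And>x. norm x \<le> C * norm (g s x)" using s by blast
    have "norm x \<le> (2 * C) * norm (g t x)" for x
    proof -
      have "norm (g s x) \<le> norm (g t x) + norm (g t x - g s x)"
        using norm_triangle_ineq4[of "g t x" "g t x - g s x"] by simp
      then have "norm (g s x) \<le> 2 * norm (g t x)" using short[OF st, of x] by simp
      then have "C * norm (g s x) \<le> C * (2 * norm (g t x))" using C(1) by (intro mult_left_mono) auto
      then show ?thesis using C(2)[of x] by simp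
    qed
    then have "\<exists>C>0. \<forall>x. norm x \<le> C * norm (g t x)" using C(1) by (intro exI[of _ "2*C"]) auto
    ultimately show "bij (blinfun_apply (g t)) \<and> (\<exists>C>0. \<forall>x. norm x \<le> C * norm (g t x))" by blast
  qed
qed

lemma bij_g: "bij (blinfun_apply (g t))"
  using g_bij_bounded_below by blast

lemma g_inv [simp]: "g t (inv (blinfun_apply (g t)) x) = x"
  by (simp add: surj_f_inv_f bij_is_surj bij_g)

lemma inv_g_eqI: "g t y = x \<Longrightarrow> inv (blinfun_apply (g t)) x = y"
  using bij_g by (metis bij_def inv_f_f)

text \<open>
  For \<open>w = g(b)\<^sup>-\<^sup>1y - v\<close> one has \<open>g(b)w = y - g(b)v\<close>, which is small because \<open>y\<close> and \<open>g(b)v\<close> are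
  both near \<open>g(s)v\<close>. The short-time estimate replaces \<open>g(b)w\<close> by \<open>g(s)w\<close>, and the
  lower bound at the fixed time \<open>s\<close> then controls \<open>w\<close>.
\<close>

lemma inv_g_jointly_continuous:
  assumes "\<eta> > 0"
  shows "\<exists>\<delta>>0. \<forall>b y. \<bar>b - s\<bar> < \<delta> \<longrightarrow> dist y (g s v) < \<delta> \<longrightarrow> dist (inv (blinfun_apply (g b)) y) v < \<eta>"
proof -
  obtain h where h: "h > 0"
    and short: "\<And>x s t. \<bar>t - s\<bar> \<le> h \<Longrightarrow> norm (g t x - g s x) \<le> norm (g s x) / 2"
    using g_short_time by blast
  obtain C where C: "C > 0" "\<And>x. norm x \<le> C * norm (g s x)" using g_bij_bounded_below by blast
  \<comment> \<open>One factor 2 from the triangle inequality, one from passing from \<open>g(b)\<close> to \<open>g(s)\<close>.\<close>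
  define \<mu> where "\<mu> = \<eta> / (4 * C)"
  have \<mu>: "\<mu> > 0" using C assms by (simp add: \<mu>_def)
  have "isCont (\<lambda>t. g t v) s" by (rule has_vector_derivative_continuous[OF g_derivative])
  then obtain r where r: "r > 0" "\<And>b. dist b s < r \<Longrightarrow> dist (g b v) (g s v) < \<mu>"
    using \<mu> unfolding continuous_at_eps_delta by blast
  have "dist (inv (blinfun_apply (g b)) y) v < \<eta>"
    if b: "\<bar>b - s\<bar> < min h (min r \<mu>)" and y: "dist y (g s v) < min h (min r \<mu>)" for b y
  proof -
    define w where "w = inv (blinfun_apply (g b)) y - v"
    have "g b w = y - g b v" by (simp add: w_def blinfun.diff_right)
    moreover have "dist y (g b v) \<le> dist y (g s v) + dist (g b v) (g s v)"
      by (rule dist_triangle2)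
    ultimately have bw: "norm (g b w) < 2 * \<mu>" using r(2)[of b] b y by (simp add: dist_norm)
    have "norm (g s w - g b w) \<le> norm (g b w) / 2" using b by (intro short) auto
    then have "norm (g s w) \<le> 2 * norm (g b w)"
      using norm_triangle_sub[of "g s w" "g b w"] norm_ge_zero[of "g b w"] by linarith
    then have "norm (g s w) < 4 * \<mu>" using bw by simp
    then have "C * norm (g s w) < C * (4 * \<mu>)" using C(1) by simp
    also have "\<dots> = \<eta>" using C(1) by (simp add: \<mu>_def)
    finally have "norm w < \<eta>" using C(2)[of w] by simp
    then show ?thesis by (simp add: w_def dist_norm)
  qed
  then show ?thesis using h r \<mu> by (intro exI[of _ "min h (min r \<mu>)"]) auto
qed

lemma discrete_flow_eq: "discrete_flow (g 1) n = blinfun_apply (g (of_int n))"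
proof -
  have pos: "(blinfun_apply (g 1) ^^ k) x = g (of_int (int k)) x" for k x
  proof (induction k)
    case (Suc k)
    then show ?case using g_add_int[of 1 "int k" x] by simp
  qed simp
  have neg: "(inv (blinfun_apply (g 1)) ^^ k) x = g (of_int (- int k)) x" for k x
  proof (induction k)
    case (Suc k)
    have "inv (blinfun_apply (g 1)) (g (of_int (- int k)) x) = g (of_int (- int (Suc k))) x"
      by (rule inv_g_eqI) (use g_add_int[of 1 "- int (Suc k)" x] in simp)
    then show ?case using Suc by simp
  qed simp
  show ?thesis
    using pos[of "nat n"] neg[of "nat (- n)"] by (auto simp: discrete_flow_def fun_eq_iff)
qed

lemma skew_flow_of_g:
  "skew_flow g t (circle_of s, g s x) = (circle_of (s + t), g (s + t) x)"
proof -
  have "g (t + 1) = g t o\<^sub>L g 1" for t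
    using g_add_int[of t 1] by (intro blinfun_eqI) simp
  from skew_flow_circle_of[OF bij_g this, of t s "g s x"] show ?thesis
    using inv_g_eqI[OF refl] by (simp add: add.commute)
qed

section \<open>The two inclusions\<close>

text \<open>
  The \<open>+ 1\<close> in the Lipschitz constant of \<open>x \<mapsto> (s, g(s)x)\<close> keeps it positive in the zero space.
\<close>

lemma chain_recurrent_lift:
  assumes x: "x \<in> chain_recurrent_set dist (discrete_flow (g 1))"
  shows "(circle_of s, g s x) \<in> chain_recurrent_set skew_dist (skew_flow g)"
proof -
  let ?f = "\<lambda>x. (circle_of s, g s x)"
  have flow: "skew_flow g (of_int n) (?f p) = ?f (discrete_flow (g 1) n p)" for n p
    by (simp add: skew_flow_of_g discrete_flow_eq g_add_int circle_of_eq_iff)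
  define K where "K = norm (g s) + 1"
  have K: "K > 0" unfolding K_def using norm_ge_zero[of "g s"] by linarith
  have d: "skew_dist (?f p) (?f q) \<le> K * dist p q" for p q
  proof -
    have "norm (g s (p - q)) \<le> norm (g s) * norm (p - q)" by (rule norm_blinfun)
    also have "\<dots> \<le> K * norm (p - q)" by (intro mult_right_mono) (auto simp: K_def)
    finally show ?thesis
      by (simp add: skew_dist_def circle_dist_def dist_norm blinfun.diff_right)
  qed
  show ?thesis
  proof (rule chain_recurrent_set_map[OF _ x, where f = ?f])
    fix e' :: "circle \<times> 'a \<Rightarrow> real" and t' :: real
    assume e': "e' \<in> positive_continuous skew_dist" and t': "t' > 0"
    define e where "e y = e' (?f y) / K" for y
    have "e \<in> positive_continuous dist"
      unfolding positive_continuous_iff[OF Met_TC.Metric_space_axioms]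
    proof (intro conjI allI impI)
      show "0 < e u" for u
        using e' K by (simp add: e_def positive_continuous_iff[OF Metric_space_skew_dist])
      fix u :: 'a and \<eta> :: real assume "\<eta> > 0"
      then have "\<eta> * K > 0" using K by simp
      then obtain \<delta> where \<delta>: "\<delta> > 0" "\<And>v. skew_dist (?f u) v < \<delta> \<Longrightarrow> \<bar>e' (?f u) - e' v\<bar> < \<eta> * K"
        using e' unfolding positive_continuous_iff[OF Metric_space_skew_dist] by blast
      have "\<bar>e u - e v\<bar> < \<eta>" if "dist u v < \<delta> / K" for v
      proof -
        have "skew_dist (?f u) (?f v) < \<delta>"
          using d[of u v] that K by (simp add: field_simps)
        then have "\<bar>e' (?f u) - e' (?f v)\<bar> / K < \<eta>" using \<delta>(2) K by (simp add: field_simps)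
        then show ?thesis using K by (simp add: e_def diff_divide_distrib[symmetric])
      qed
      then show "\<exists>\<delta>>0. \<forall>v. dist u v < \<delta> \<longrightarrow> \<bar>e u - e v\<bar> < \<eta>"
        using \<delta>(1) K by (intro exI[of _ "\<delta> / K"]) auto
    qed
    moreover have "\<exists>\<tau>'>t'. skew_dist (?f q) (skew_flow g \<tau>' (?f p)) < e' (skew_flow g \<tau>' (?f p))"
      if "n > \<lceil>t'\<rceil>" "dist q (discrete_flow (g 1) n p) < e (discrete_flow (g 1) n p)" for p q n
    proof (intro exI[of _ "of_int n"] conjI)
      show "t' < of_int n" using that(1) by linarith
      have "K * dist q (discrete_flow (g 1) n p) < e' (?f (discrete_flow (g 1) n p))"
        using that(2) K by (simp add: e_def field_simps)
      then show "skew_dist (?f q) (skew_flow g (of_int n) (?f p)) < e' (skew_flow g (of_int n) (?f p))"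
        unfolding flow using d[of q "discrete_flow (g 1) n p"] by simp
    qed
    moreover have "\<lceil>t'\<rceil> > 0" using t' by simp
    ultimately show "\<exists>e\<in>positive_continuous dist. \<exists>t>0. \<forall>p q. \<forall>\<tau>>t.
        dist q (discrete_flow (g 1) \<tau> p) < e (discrete_flow (g 1) \<tau> p) \<longrightarrow>
        (\<exists>\<tau>'>t'. skew_dist (?f q) (skew_flow g \<tau>' (?f p)) < e' (skew_flow g \<tau>' (?f p)))"
      by blast
  qed
qed

text \<open>
  The fibre coordinate at the last passage through the fibre over \<open>0\<close>: flowing on from there
  for the time \<open>circle_rep (fst p)\<close> leads to \<open>p\<close>.
\<close>

definition section_coord :: "circle \<times> 'a \<Rightarrow> 'a" where
  "section_coord p = inv (blinfun_apply (g (circle_rep (fst p)))) (snd p)"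

lemma section_coord_eq: "(circle_of (circle_rep (fst p)), g (circle_rep (fst p)) (section_coord p)) = p"
  by (simp add: section_coord_def circle_of_circle_rep)

lemma section_coord_flow:
  "section_coord (skew_flow g t p) = g (of_int \<lfloor>circle_rep (fst p) + t\<rfloor>) (section_coord p)"
proof -
  define s where "s = circle_rep (fst p)"
  have "skew_flow g t p = (circle_of (s + t), g (s + t) (section_coord p))"
    using skew_flow_of_g[of t s "section_coord p"] section_coord_eq[of p] by (simp add: s_def)
  moreover have "g (s + t) (section_coord p)
      = g (frac (s + t)) (g (of_int \<lfloor>s + t\<rfloor>) (section_coord p))"
    using g_add_int[of "frac (s + t)" "\<lfloor>s + t\<rfloor>"] by (simp add: frac_def)
  ultimately show ?thesis
    using inv_g_eqI[OF refl] by (simp add: section_coord_def circle_rep_circle_of flip: s_def)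
qed

text \<open>
  The representative \<open>s'\<close> of a point \<open>q\<close> near \<open>p\<close> need not be near the representative \<open>s\<close> of \<open>p\<close>, but
  one of \<open>s' - 1\<close>, \<open>s'\<close>, \<open>s' + 1\<close> is. Computing the fibre coordinate with this number instead
  of \<open>s'\<close> depends continuously on \<open>q\<close> and differs from \<open>section_coord q\<close> by a power of \<open>g\<close>.
\<close>

lemma section_coord_near:
  assumes "\<eta> > 0"
  shows "\<exists>r>0. \<forall>q. skew_dist p q < r \<longrightarrow>
    (\<exists>m\<in>{-1,0,1::int}. \<exists>u. dist u (section_coord p) < \<eta> \<and> section_coord q = g (of_int m) u)"
proof -
  let ?s = "circle_rep (fst p)"
  obtain r where r: "r > 0"
    and near: "\<And>b y. \<lbrakk>\<bar>b - ?s\<bar> < r; dist y (g ?s (section_coord p)) < r\<rbrakk>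
      \<Longrightarrow> dist (inv (blinfun_apply (g b)) y) (section_coord p) < \<eta>"
    using inv_g_jointly_continuous[OF assms, of ?s "section_coord p"] by blast
  have gp: "g ?s (section_coord p) = snd p" by (simp add: section_coord_def)
  have "\<exists>m\<in>{-1,0,1::int}. \<exists>u. dist u (section_coord p) < \<eta> \<and> section_coord q = g (of_int m) u"
    if pq: "skew_dist p q < r" for q
  proof -
    let ?s' = "circle_rep (fst q)"
    have nn: "0 \<le> circle_dist (fst p) (fst q)"
      using circle_rep_bounds[of "fst p"] circle_rep_bounds[of "fst q"] by (simp add: circle_dist_def)
    then have y: "dist (snd q) (snd p) < r" and "circle_dist (fst p) (fst q) < r"
      using pq zero_le_dist[of "snd p" "snd q"] unfolding skew_dist_def dist_commute[of "snd q"]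
      by linarith+
    then have "\<bar>?s' - ?s\<bar> < r \<or> 1 - \<bar>?s' - ?s\<bar> < r"
      by (auto simp: circle_dist_def min_def abs_minus_commute split: if_splits)
    moreover have "1 - \<bar>?s' - ?s\<bar> = \<bar>?s' - 1 - ?s\<bar> \<or> 1 - \<bar>?s' - ?s\<bar> = \<bar>?s' + 1 - ?s\<bar>"
      using circle_rep_bounds[of "fst p"] circle_rep_bounds[of "fst q"]
      by (cases "?s \<le> ?s'") auto
    ultimately have "\<bar>?s' - ?s\<bar> < r \<or> \<bar>?s' + 1 - ?s\<bar> < r \<or> \<bar>?s' - 1 - ?s\<bar> < r"
      by auto
    then have "\<exists>m\<in>{-1,0,1::int}. \<bar>?s' + of_int m - ?s\<bar> < r" by auto
    then obtain m where m: "m \<in> {-1,0,1::int}" "\<bar>?s' + of_int m - ?s\<bar> < r" by blast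
    define u where "u = inv (blinfun_apply (g (?s' + of_int m))) (snd q)"
    have "g ?s' (g (of_int m) u) = snd q"
      unfolding u_def g_add_int[symmetric] by (rule g_inv)
    then have "section_coord q = g (of_int m) u"
      unfolding section_coord_def by (rule inv_g_eqI)
    moreover have "dist u (section_coord p) < \<eta>"
      unfolding u_def using m(2) y by (intro near) (simp_all add: gp)
    ultimately show ?thesis using m(1) by blast
  qed
  then show ?thesis using r by blast
qed

text \<open>
  The bound 2 is the largest difference of two exponents from \<open>{-1, 0, 1}\<close>, one for each
  endpoint of the jump. The error function is evaluated at the arrival point of the orbit of
  \<open>g\<close>, as in the definition of a chain.
\<close>

definition good_jump :: "('a \<Rightarrow> real) \<Rightarrow> circle \<times> 'a \<Rightarrow> circle \<times> 'a \<Rightarrow> bool" where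
  "good_jump e p q \<longleftrightarrow> (\<exists>j::int. \<bar>j\<bar> \<le> 2 \<and>
     dist (section_coord q) (g (of_int j) (section_coord p)) < e (g (of_int j) (section_coord p)))"

text \<open>
  If \<open>Z(q) = g\<^sup>mu\<close> and \<open>Z(q') = g\<^sup>m\<^sup>'u'\<close> with \<open>u\<close>, \<open>u'\<close> near \<open>Z(p)\<close>, then \<open>g\<^sup>m\<^sup>'u = g\<^sup>jZ(q)\<close> for
  \<open>j = m' - m\<close>, and \<open>Z(q') = g\<^sup>m\<^sup>'u'\<close> is close to it by continuity of \<open>g\<^sup>m\<^sup>'\<close>. Only three values of
  \<open>m'\<close> occur, so one neighbourhood serves them all.
\<close>

lemma good_jump_local:
  assumes e: "e \<in> positive_continuous dist"
  shows "\<exists>r>0. \<forall>q q'. skew_dist p q < r \<longrightarrow> skew_dist p q' < r \<longrightarrow> good_jump e q q'"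
proof -
  let ?z = "section_coord p"
  have "\<exists>\<eta>>0. \<forall>u v. dist u ?z < \<eta> \<longrightarrow> dist v ?z < \<eta> \<longrightarrow> dist (g (of_int m) u) (g (of_int m) v) < e (g (of_int m) v)"
    for m
  proof -
    let ?G = "blinfun_apply (g (of_int m))"
    define E where "E = e (?G ?z)"
    have E: "E > 0" using e by (simp add: E_def positive_continuous_iff[OF Met_TC.Metric_space_axioms])
    then have "E / 2 > 0" by simp
    then obtain \<delta> where \<delta>: "\<delta> > 0" "\<And>v. dist (?G ?z) v < \<delta> \<Longrightarrow> \<bar>E - e v\<bar> < E / 2"
      using e unfolding positive_continuous_iff[OF Met_TC.Metric_space_axioms] E_def by blast
    have "isCont ?G ?z" by (simp add: linear_continuous_at blinfun.bounded_linear_right)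
    moreover have "min \<delta> (E / 4) > 0" using \<delta> E by simp
    ultimately obtain \<eta> where \<eta>: "\<eta> > 0" "\<And>u. dist u ?z < \<eta> \<Longrightarrow> dist (?G u) (?G ?z) < min \<delta> (E / 4)"
      unfolding continuous_at_eps_delta by blast
    have "dist (?G u) (?G v) < e (?G v)" if "dist u ?z < \<eta>" "dist v ?z < \<eta>" for u v
    proof -
      have "\<bar>E - e (?G v)\<bar> < E / 2" using \<eta>(2)[OF that(2)] by (intro \<delta>(2)) (simp add: dist_commute)
      moreover have "dist (?G u) (?G ?z) < E / 4" "dist (?G v) (?G ?z) < E / 4"
        using \<eta>(2) that by simp_all
      ultimately show ?thesis
        using dist_triangle2[of "?G u" "?G v" "?G ?z"] by linarith
    qed
    then show ?thesis using \<eta>(1) by blast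
  qed
  then obtain \<eta> where \<eta>: "\<And>m. \<eta> m > 0"
    and close: "\<And>m u v. \<lbrakk>dist u ?z < \<eta> m; dist v ?z < \<eta> m\<rbrakk>
      \<Longrightarrow> dist (g (of_int m) u) (g (of_int m) v) < e (g (of_int m) v)" by metis
  define \<mu> where "\<mu> = Min (\<eta> ` {-1,0,1})"
  have "\<mu> > 0" unfolding \<mu>_def using \<eta> by (subst Min_gr_iff) auto
  then obtain r where r: "r > 0"
    and near: "\<And>q. skew_dist p q < r \<Longrightarrow>
      \<exists>m\<in>{-1,0,1::int}. \<exists>u. dist u ?z < \<mu> \<and> section_coord q = g (of_int m) u"
    using section_coord_near by blast
  have "good_jump e q q'" if "skew_dist p q < r" "skew_dist p q' < r" for q q'
  proof -
    obtain m u where m: "m \<in> {-1,0,1::int}" "dist u ?z < \<mu>" "section_coord q = g (of_int m) u"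
      using near[OF \<open>skew_dist p q < r\<close>] by blast
    obtain m' u' where m': "m' \<in> {-1,0,1::int}" "dist u' ?z < \<mu>" "section_coord q' = g (of_int m') u'"
      using near[OF \<open>skew_dist p q' < r\<close>] by blast
    have "\<mu> \<le> \<eta> m'" unfolding \<mu>_def using m'(1) by (intro Min_le) auto
    then have "dist (g (of_int m') u') (g (of_int m') u) < e (g (of_int m') u)"
      using m(2) m'(2) by (intro close) auto
    moreover have "g (of_int (m' - m)) (section_coord q) = g (of_int m') u"
      using g_add_int[of "of_int (m' - m)" m u] m(3) by simp
    moreover have "\<bar>m' - m\<bar> \<le> 2" using m(1) m'(1) by auto
    ultimately show ?thesis unfolding good_jump_def using m'(3) by (intro exI[of _ "m' - m"]) auto
  qed
  then show ?thesis using r by blast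
qed

lemma good_jump_gauge:
  assumes e': "e' \<in> positive_continuous dist"
  shows "\<exists>e\<in>positive_continuous skew_dist. \<forall>p q. skew_dist q p < e p \<longrightarrow> good_jump e' p q"
proof -
  interpret S: Metric_space UNIV "skew_dist :: circle \<times> 'a \<Rightarrow> circle \<times> 'a \<Rightarrow> real"
    by (rule Metric_space_skew_dist)
  have "\<exists>e\<in>positive_continuous skew_dist. \<forall>p. \<forall>q. skew_dist q p < e p \<longrightarrow> good_jump e' p q"
  proof (rule positive_continuous_selection[OF Metric_space_skew_dist])
    fix p
    obtain r where r: "r > 0" "\<And>q q'. \<lbrakk>skew_dist p q < r; skew_dist p q' < r\<rbrakk> \<Longrightarrow> good_jump e' q q'"
      using good_jump_local[OF e'] by blast
    \<comment> \<open>Halving \<open>r\<close> puts both endpoints of the jump into the \<open>r\<close>-ball around \<open>p\<close>.\<close>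
    have "good_jump e' q q'" if "skew_dist p q < r / 2" "skew_dist q' q < r / 2" for q q'
      using that S.triangle[of p q q'] S.commute[of q q'] r(1) by (intro r(2)) auto
    then show "\<exists>r>0. \<forall>q. skew_dist p q < r \<longrightarrow> (\<forall>q'. skew_dist q' q < r \<longrightarrow> good_jump e' q q')"
      using r(1) by (intro exI[of _ "r / 2"]) auto
  qed auto
  then show ?thesis by blast
qed

lemma chain_recurrent_section_coord:
  assumes p: "p \<in> chain_recurrent_set skew_dist (skew_flow g)"
  shows "section_coord p \<in> chain_recurrent_set dist (discrete_flow (g 1))"
proof (rule chain_recurrent_set_map[OF _ p])
  fix e' :: "'a \<Rightarrow> real" and N :: int
  assume e': "e' \<in> positive_continuous dist" and N: "N > 0"
  obtain e where e: "e \<in> positive_continuous skew_dist"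
    and good: "\<And>p q. skew_dist q p < e p \<Longrightarrow> good_jump e' p q"
    using good_jump_gauge[OF e'] by blast
  \<comment> \<open>Rounding the flow time down to the number of passages and the exponent \<open>j \<ge> -2\<close>
      together cost less than 3.\<close>
  have "\<exists>n>N. dist (section_coord q) (discrete_flow (g 1) n (section_coord p))
      < e' (discrete_flow (g 1) n (section_coord p))"
    if t: "t > of_int N + 3" and q: "skew_dist q (skew_flow g t p) < e (skew_flow g t p)" for p q t
  proof -
    define k where "k = \<lfloor>circle_rep (fst p) + t\<rfloor>"
    obtain j :: int where j: "\<bar>j\<bar> \<le> 2" and
      *: "dist (section_coord q) (g (of_int j) (section_coord (skew_flow g t p)))
        < e' (g (of_int j) (section_coord (skew_flow g t p)))"
      using good[OF q] unfolding good_jump_def by blast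
    have "k \<ge> N + 3" unfolding k_def le_floor_iff using t circle_rep_bounds[of "fst p"] by simp
    then have "j + k > N" using j by linarith
    moreover have "g (of_int j) (section_coord (skew_flow g t p)) = discrete_flow (g 1) (j + k) (section_coord p)"
      using g_add_int[of "of_int j" k "section_coord p"]
      by (simp add: section_coord_flow discrete_flow_eq flip: k_def)
    ultimately show ?thesis using * by auto
  qed
  moreover have "(0::real) < of_int N + 3" using N by simp
  ultimately show "\<exists>e\<in>positive_continuous skew_dist. \<exists>t>0. \<forall>p q. \<forall>\<tau>>t.
      skew_dist q (skew_flow g \<tau> p) < e (skew_flow g \<tau> p) \<longrightarrow>
      (\<exists>n>N. dist (section_coord q) (discrete_flow (g 1) n (section_coord p))
        < e' (discrete_flow (g 1) n (section_coord p)))"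
    using e by blast
qed

end

theorem theorem3p3:
  fixes X g :: "real \<Rightarrow> ('a::banach \<Rightarrow>\<^sub>L 'a)"
  assumes "continuous_on UNIV X"
    and "\<And>t. X (t + 1) = X t"
    and "fundamental_solution X g"
  shows "chain_recurrent_set skew_dist (skew_flow g)
    = twisted_product g (chain_recurrent_set dist (discrete_flow (g 1)))"
proof -
  interpret periodic_linear_ode X g
    by standard (fact assms)+
  show ?thesis
  proof (intro equalityI subsetI)
    fix p assume "p \<in> chain_recurrent_set skew_dist (skew_flow g)"
    from chain_recurrent_section_coord[OF this]
    show "p \<in> twisted_product g (chain_recurrent_set dist (discrete_flow (g 1)))"
      by (subst section_coord_eq[of p, symmetric]) (auto simp: twisted_product_def)
  next
    fix p assume "p \<in> twisted_product g (chain_recurrent_set dist (discrete_flow (g 1)))"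
    then show "p \<in> chain_recurrent_set skew_dist (skew_flow g)"
      unfolding twisted_product_def using chain_recurrent_lift by blast
  qed
qed

end
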